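(* Let $a\le r$ be positive integers and let $\epsilon\in(0,0.5)$. Then there are infinitely many $n\ge r^{\Omega(r/\epsilon)}$ (each a multiple of $r$) such that, for any positive integer $h$ with $hr\ge\Omega(n^{1-\epsilon})$ (and $\frac nr a+h<n$), there is an MR $(n,r,h,a)$-LRC over a field of size at most $n^{\epsilon h}$.
   Context: Definition: let $\ell$ be a prime power, $a,g,r,h$ positive integers with $ga+h<gr$, $n=gr$, $k=n-ga-h$. An MR (maximally recoverable) $(n,r,h,a)_\ell$-LRC is an $[n,k]$ linear code over $\mathbb{F}_\ell$ with a parity-check matrix $H$ of the block form whose first $ga$ rows are block diagonal with diagonal blocks $A_1,\dots,A_g$ (each $a\times r$, coordinates split into $g$ consecutive groups of size $r$) and whose last $h$ rows are $(D_1|\cdots|D_g)$ with each $D_i$ of size $h\times r$, such that (i) each $A_i$ generates an $[r,a,r-a+1]_\ell$ MDS code, and (ii) every set of $ag+h$ columns of $H$ consisting of any $a$ columns from each group together with any $h$ further columns is linearly independent over $\mathbb{F}_\ell$. "Over a field of size $\ell$" means an MR $(n,r,h,a)_\ell$-LRC. $\Omega(\cdot)$ is the usual asymptotic notation (lower bound up to an absolute positive constant). *)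

theory Defs
  imports "HOL-Algebra.Ring" "HOL-Algebra.Coset" Complex_Main
begin

text \<open>Matrices over a field F (HOL-Algebra) are functions nat => nat => 'a,
  entry (i,j) = row i, column j; only the entries in the relevant index range matter.\<close>

definition cols_indep :: "('a, 'b) ring_scheme \<Rightarrow> nat \<Rightarrow> (nat \<Rightarrow> nat \<Rightarrow> 'a) \<Rightarrow> nat set \<Rightarrow> bool" where
  "cols_indep F m H S \<longleftrightarrow>
     (\<forall>c. (\<forall>j\<in>S. c j \<in> carrier F) \<longrightarrow>
          (\<forall>i<m. finsum F (\<lambda>j. c j \<otimes>\<^bsub>F\<^esub> H i j) S = \<zero>\<^bsub>F\<^esub>) \<longrightarrow>
          (\<forall>j\<in>S. c j = \<zero>\<^bsub>F\<^esub>))"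

definition codeword :: "('a, 'b) ring_scheme \<Rightarrow> nat \<Rightarrow> (nat \<Rightarrow> nat \<Rightarrow> 'a) \<Rightarrow> (nat \<Rightarrow> 'a) \<Rightarrow> nat \<Rightarrow> 'a" where
  "codeword F a A u j = finsum F (\<lambda>i. u i \<otimes>\<^bsub>F\<^esub> A i j) {..<a}"

definition hweight :: "('a, 'b) ring_scheme \<Rightarrow> nat \<Rightarrow> (nat \<Rightarrow> 'a) \<Rightarrow> nat" where
  "hweight F r x = card {j. j < r \<and> x j \<noteq> \<zero>\<^bsub>F\<^esub>}"

definition generates_code :: "('a, 'b) ring_scheme \<Rightarrow> nat \<Rightarrow> nat \<Rightarrow> nat \<Rightarrow> (nat \<Rightarrow> nat \<Rightarrow> 'a) \<Rightarrow> bool" where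
  "generates_code F r a d A \<longleftrightarrow>
     (\<forall>i<a. \<forall>j<r. A i j \<in> carrier F) \<and>
     (\<forall>u. (\<forall>i<a. u i \<in> carrier F) \<longrightarrow> (\<forall>j<r. codeword F a A u j = \<zero>\<^bsub>F\<^esub>) \<longrightarrow> (\<forall>i<a. u i = \<zero>\<^bsub>F\<^esub>)) \<and>
     (\<forall>u. (\<forall>i<a. u i \<in> carrier F) \<longrightarrow> hweight F r (codeword F a A u) > 0 \<longrightarrow>
          hweight F r (codeword F a A u) \<ge> d) \<and>
     (\<exists>u. (\<forall>i<a. u i \<in> carrier F) \<and> hweight F r (codeword F a A u) > 0 \<and>
          hweight F r (codeword F a A u) = d)"

text \<open>H is a parity-check matrix of an MR (n,r,h,a)-LRC over F, with g = n div r groups.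
  Rows 0..<g*a are the local rows (block diagonal with blocks A_t), rows g*a..<g*a+h are
  the global rows (D_1|...|D_g). Column j lies in group j div r.\<close>
definition MR_LRC_matrix :: "('a, 'b) ring_scheme \<Rightarrow> nat \<Rightarrow> nat \<Rightarrow> nat \<Rightarrow> nat \<Rightarrow> (nat \<Rightarrow> nat \<Rightarrow> 'a) \<Rightarrow> bool" where
  "MR_LRC_matrix F n r h a H \<longleftrightarrow>
     (let g = n div r in
       (\<forall>i<g*a+h. \<forall>j<n. H i j \<in> carrier F) \<and>
       (\<forall>i<g*a. \<forall>j<n. j div r \<noteq> i div a \<longrightarrow> H i j = \<zero>\<^bsub>F\<^esub>) \<and>
       (\<forall>t<g. generates_code F r a (r - a + 1) (\<lambda>i j. H (t*a + i) (t*r + j))) \<and>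
       (\<forall>S. S \<subseteq> {..<n} \<longrightarrow> card S = g*a + h \<longrightarrow>
            (\<forall>t<g. card {j\<in>S. j div r = t} \<ge> a) \<longrightarrow> cols_indep F (g*a+h) H S))"

text \<open>There is an MR (n,r,h,a)-LRC over the (finite) field F: the parameters are admissible
  (a, g, r, h positive, n = g r, g a + h < g r) and a parity-check matrix as above exists;
  the code is the null space of H, which then has dimension n - g a - h.\<close>
definition MR_LRC_exists :: "('a, 'b) ring_scheme \<Rightarrow> nat \<Rightarrow> nat \<Rightarrow> nat \<Rightarrow> nat \<Rightarrow> bool" where
  "MR_LRC_exists F n r h a \<longleftrightarrow>
     field F \<and> finite (carrier F) \<and>
     0 < a \<and> 0 < r \<and> 0 < h \<and> 0 < n \<and> r dvd n \<and> (n div r) * a + h < n \<and>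
     (\<exists>H. MR_LRC_matrix F n r h a H)"

end

theory Submission
  imports Defs "HOL-Algebra.Algebraic_Closure_Type" "HOL-Algebra.Weak_Morphisms" "HOL-Library.Z2"
begin

text \<open>
  The code is a linearized Reed-Solomon construction, obtained by rescaling the columns of a Moore
  matrix. Let q be a power of 2, n = (q - 1) r, and let K be the field with q^r elements inside the
  algebraic closure of the field with two elements. For each nonzero element v_t of the field F_q
  pick b_t in the closure with b_t^(q^r - 1) = v_t, and let beta_0, ..., beta_(r-1) be an F_q-basis
  of K. The spaces b_t K are eigenspaces of x |-> x^(q^r) for the distinct eigenvalues v_t, so the n
  elements gamma_j = b_t beta_l are linearly independent over F_q. The blocks A_t are Vandermonde
  matrices over F_q, and the global rows are gamma_j^(q^i) / b_t = beta_l^(q^i) b_t^(q^i - 1), whose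
  entries lie in K because b_t^(q - 1) does.

  For a set S of ga + h admissible columns, suppose some combination of the rows vanishes on S, with
  coefficients f_i on the global rows. Then L(x) = sum_i f_i x^(q^i) maps each of the q^(ga + h)
  elements sum_j u_j gamma_j (with u in F_q^S) to a value determined by the ga numbers
  sum_j u_j A_(k,j) in F_q. If f is nonzero, each value is taken at most q^(h - 1) times, which is
  too few. So f = 0, and the Vandermonde blocks then force the local coefficients to vanish.

  The field has q^r elements, at most n^(2r), while h is at least of order n^(1/2) / r. Hence
  q^r is at most n^(eps h) as soon as n is large in terms of r and eps.
\<close>

section \<open>Finite subfields as fixed points of powers of Frobenius\<close>

text \<open>For N a power of the characteristic and an algebraically closed ambient field, this is the
  subfield with N elements.\<close>
definition frob_fix :: "nat \<Rightarrow> 'a::field set" where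
  "frob_fix N = {x. x ^ N = x}"

lemma frob_fix_closed:
  fixes x y :: "'a::field"
  assumes "prime CHAR('a)" and N: "N = CHAR('a) ^ k"
  shows "0 \<in> (frob_fix N :: 'a set)" "1 \<in> (frob_fix N :: 'a set)"
    "x \<in> frob_fix N \<Longrightarrow> y \<in> frob_fix N \<Longrightarrow> x + y \<in> frob_fix N"
    "x \<in> frob_fix N \<Longrightarrow> y \<in> frob_fix N \<Longrightarrow> x - y \<in> frob_fix N"
    "x \<in> frob_fix N \<Longrightarrow> y \<in> frob_fix N \<Longrightarrow> x * y \<in> frob_fix N"
    "x \<in> frob_fix N \<Longrightarrow> inverse x \<in> frob_fix N"
proof -
  have "CHAR('a) > 0" using assms(1) by (simp add: prime_gt_0_nat)
  then have "N > 0" using N by simp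
  then show "0 \<in> (frob_fix N :: 'a set)" by (simp add: frob_fix_def)
  show "1 \<in> (frob_fix N :: 'a set)" by (simp add: frob_fix_def)
  show "x \<in> frob_fix N \<Longrightarrow> y \<in> frob_fix N \<Longrightarrow> x + y \<in> frob_fix N"
    using freshmans_dream'[OF assms] by (simp add: frob_fix_def)
  show "x \<in> frob_fix N \<Longrightarrow> y \<in> frob_fix N \<Longrightarrow> x - y \<in> frob_fix N"
    \<comment> \<open>Additivity is applied to \<open>(x - y) + y = x\<close>, which avoids
      determining the sign of \<open>(- 1) ^ N\<close>.\<close>
    using freshmans_dream'[OF assms, of "x - y" y] by (simp add: frob_fix_def algebra_simps)
  show "x \<in> frob_fix N \<Longrightarrow> y \<in> frob_fix N \<Longrightarrow> x * y \<in> frob_fix N"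
    by (simp add: frob_fix_def power_mult_distrib)
  show "x \<in> frob_fix N \<Longrightarrow> inverse x \<in> frob_fix N"
    by (simp add: frob_fix_def power_inverse)
qed

lemma frob_fix_sum:
  fixes f :: "'b \<Rightarrow> 'a::field"
  assumes "prime CHAR('a)" "N = CHAR('a) ^ k" "\<And>i. i \<in> A \<Longrightarrow> f i \<in> frob_fix N"
  shows "sum f A \<in> frob_fix N"
  using assms(3)
  by (induction A rule: infinite_finite_induct) (auto intro: frob_fix_closed[OF assms(1,2)])

lemma frob_fix_power: "x \<in> frob_fix N \<Longrightarrow> x ^ m \<in> frob_fix N"
  by (simp add: frob_fix_def flip: power_mult) (metis mult.commute power_mult)

lemma frob_fix_iterate:
  assumes "x \<in> frob_fix N"
  shows "x ^ (N ^ k) = x"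
proof (induction k)
  case (Suc k)
  have "x ^ (N ^ Suc k) = (x ^ N) ^ (N ^ k)" by (simp add: power_mult)
  then show ?case using assms Suc by (simp add: frob_fix_def)
qed simp

text \<open>The polynomial \<open>X ^ N - X\<close> splits over the algebraically closed field.
  Since \<open>N\<close> vanishes there (\<open>k > 0\<close>), its derivative is the constant -1,
  so its \<open>N\<close> roots are distinct.\<close>

lemma card_frob_fix:
  assumes "prime CHAR('a::alg_closed_field)" and N: "N = CHAR('a) ^ k" and "k > 0"
  shows "finite (frob_fix N :: 'a set)" "card (frob_fix N :: 'a set) = N"
proof -
  define p :: "'a poly" where "p = Polynomial.monom 1 N - Polynomial.monom 1 1"
  have "CHAR('a) > 1" using assms(1) by (rule prime_gt_1_nat)
  then have "N > 1" using N \<open>k > 0\<close> by (metis one_less_power)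
  have "of_nat N = (0 :: 'a)" using N \<open>k > 0\<close> by (simp add: of_nat_power)
  then have pd: "pderiv p = -1"
    by (simp add: p_def pderiv_diff pderiv_monom)
  have deg: "degree p = N"
    using \<open>N > 1\<close> unfolding p_def diff_conv_add_uminus
    by (subst degree_add_eq_left) (simp_all add: degree_monom_eq)
  have "p \<noteq> 0" using deg \<open>N > 1\<close> by auto
  have roots: "poly p x = 0 \<longleftrightarrow> x \<in> frob_fix N" for x
    by (simp add: p_def frob_fix_def poly_monom)
  then have fx: "frob_fix N = {x. poly p x = 0}" by auto
  show fin: "finite (frob_fix N :: 'a set)"
    unfolding fx using \<open>p \<noteq> 0\<close> by (rule poly_roots_finite)
  obtain A where A: "size A = N" "p = smult (lead_coeff p) (\<Prod>x\<in>#A. [:-x, 1:])"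
    using alg_closed_imp_factorization[OF \<open>p \<noteq> 0\<close>] deg by auto
  have count: "count A x \<le> 1" for x
  proof (rule ccontr)
    assume "\<not> count A x \<le> 1"
    \<comment> \<open>A repeated root \<open>x\<close> gives \<open>p = (X - x) ^ 2 * s\<close>. By
      the product rule \<open>x\<close> is then also a root of \<open>pderiv p\<close>, which is
      -1.\<close>
    then have "count A x \<ge> 2" by simp
    then have "{#x, x#} \<subseteq># A" by (auto simp: subseteq_mset_def)
    then obtain B where "A = {#x, x#} + B" using subset_mset.le_iff_add by metis
    then obtain s where ps: "p = [:-x, 1:] * ([:-x, 1:] * s)"
      using A(2) by (metis (no_types, lifting) add_mset_add_single image_mset_add_mset
          mult_smult_right prod_mset.add_mset union_mset_add_mset_left empty_neutral(1))
    have deriv: "poly (pderiv ([:-x, 1:] * t)) x = poly t x" for t :: "'a poly"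
      by (subst pderiv_mult) (simp add: pderiv_pCons del: mult_pCons_left)
    have "poly (pderiv p) x = poly ([:-x, 1:] * s) x" by (subst ps) (rule deriv)
    then have "poly (pderiv p) x = 0" by simp
    then show False by (simp add: pd)
  qed
  have "set_mset A \<subseteq> frob_fix N"
  proof
    fix x assume "x \<in># A"
    then obtain B where "A = add_mset x B" by (metis mset_add)
    then have "poly p x = 0" by (subst A(2)) simp
    then show "x \<in> frob_fix N" using roots by simp
  qed
  then have "card (set_mset A) \<le> card (frob_fix N :: 'a set)" by (rule card_mono[OF fin])
  moreover have "size A \<le> card (set_mset A)"
    unfolding size_multiset_overloaded_eq
    using sum_mono[of "set_mset A" "count A" "\<lambda>_. 1"] count by simp
  moreover have "card (frob_fix N :: 'a set) \<le> N"
    unfolding fx using card_poly_roots_bound[OF \<open>p \<noteq> 0\<close>] deg by simp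
  ultimately show "card (frob_fix N :: 'a set) = N" using A(1) by linarith
qed

section \<open>Counting values of linearized polynomials\<close>

text \<open>The fibre is the root set of a polynomial of degree at most \<open>q ^ (h - 1)\<close>.
  It is nonzero: \<open>q \<ge> 2\<close> makes the exponents \<open>q ^ i\<close> distinct and
  positive, so the coefficient at \<open>q ^ i0\<close> is exactly \<open>f i0\<close>, untouched by
  the constant \<open>v\<close>.\<close>

lemma card_linearized_fibre_le:
  fixes f :: "nat \<Rightarrow> 'a::field" and v :: 'a
  assumes "q \<ge> 2" and i0: "i0 < h" "f i0 \<noteq> 0"
  defines "Z \<equiv> {x. (\<Sum>i<h. f i * x ^ (q ^ i)) = v}"
  shows "finite Z" "card Z \<le> q ^ (h - 1)"
proof -
  define p where "p = (\<Sum>i<h. Polynomial.monom (f i) (q ^ i)) - [:v:]"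
  have Z: "Z = {x. poly p x = 0}"
    by (simp add: Z_def p_def poly_sum poly_monom)
  have "Polynomial.coeff p (q ^ i0) = (\<Sum>i<h. if i = i0 then f i else 0) - Polynomial.coeff [:v:] (q ^ i0)"
    using \<open>q \<ge> 2\<close> by (auto simp: p_def coeff_sum coeff_monom intro!: sum.cong)
  also have "Polynomial.coeff [:v:] (q ^ i0) = 0"
    using \<open>q \<ge> 2\<close> by (simp add: coeff_pCons split: nat.splits)
  finally have "Polynomial.coeff p (q ^ i0) = f i0" using i0 by simp
  then have "p \<noteq> 0" using i0 by auto
  have "degree p \<le> q ^ (h - 1)" unfolding p_def
  proof (intro degree_diff_le degree_sum_le)
    fix i assume "i \<in> {..<h}"
    then have "q ^ i \<le> q ^ (h - 1)" using \<open>q \<ge> 2\<close> by (intro power_increasing) auto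
    then show "degree (Polynomial.monom (f i) (q ^ i)) \<le> q ^ (h - 1)"
      using degree_monom_le order_trans by blast
  qed auto
  then show "card Z \<le> q ^ (h - 1)"
    unfolding Z using card_poly_roots_bound[OF \<open>p \<noteq> 0\<close>] by linarith
  show "finite Z" unfolding Z using \<open>p \<noteq> 0\<close> by (rule poly_roots_finite)
qed

text \<open>Pigeonhole against root counting. Some vector \<open>v\<close> of the \<open>m\<close>
  sums formed with \<open>A\<close> is shared by at least \<open>q ^ h\<close> coefficient vectors
  \<open>u\<close>. Their combinations of the \<open>\<gamma> j\<close> are pairwise distinct, yet
  for \<open>f i0 \<noteq> 0\<close> all of them lie in one fibre of size at most
  \<open>q ^ (h - 1)\<close>. Only \<open>u\<close> and \<open>A\<close> have to be over the small
  field; \<open>f\<close> and \<open>w\<close> are arbitrary.\<close>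

lemma linearized_combination_zero:
  fixes \<gamma> :: "'b \<Rightarrow> 'a::alg_closed_field" and f :: "nat \<Rightarrow> 'a"
  assumes char: "prime CHAR('a)" "q = CHAR('a) ^ s" "s > 0"
    and S: "finite S" "card S = m + h"
    and indep: "\<And>u j. (\<And>j. j \<in> S \<Longrightarrow> u j \<in> frob_fix q) \<Longrightarrow> (\<Sum>j\<in>S. u j * \<gamma> j) = 0 \<Longrightarrow>
      j \<in> S \<Longrightarrow> u j = 0"
    and A: "\<And>k j. k < m \<Longrightarrow> j \<in> S \<Longrightarrow> A k j \<in> frob_fix q"
    and rel: "\<And>j. j \<in> S \<Longrightarrow> (\<Sum>i<h. f i * \<gamma> j ^ (q ^ i)) = (\<Sum>k<m. w k * A k j)"
    and "i0 < h"
  shows "f i0 = 0"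
proof (rule ccontr)
  assume nz: "f i0 \<noteq> 0"
  let ?F = "frob_fix q :: 'a set"
  have F: "finite ?F" "card ?F = q" using card_frob_fix[OF char] by auto
  have "CHAR('a) > 1" using char(1) by (rule prime_gt_1_nat)
  then have "q \<ge> 2" using char(2,3) by (metis Suc_1 Suc_leI one_less_power)
  define U where "U = PiE S (\<lambda>_. ?F)"
  define V where "V = PiE {..<m} (\<lambda>_. ?F)"
  define P where "P u = (\<lambda>k\<in>{..<m}. \<Sum>j\<in>S. u j * A k j)" for u
  define G where "G u = (\<Sum>j\<in>S. u j * \<gamma> j)" for u
  have UV: "finite U" "finite V" "card U = q ^ (m + h)" "card V = q ^ m" "V \<noteq> {}"
    using F S frob_fix_closed(1)[OF char(1,2)]
    by (auto simp: U_def V_def card_PiE finite_PiE PiE_eq_empty_iff)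
  have "P u \<in> V" if "u \<in> U" for u
    unfolding P_def V_def
  proof (intro restrict_PiE_iff[THEN iffD2] ballI frob_fix_sum[OF char(1,2)])
    fix k j assume "k \<in> {..<m}" "j \<in> S"
    then show "u j * A k j \<in> ?F"
      using that A by (intro frob_fix_closed(5)[OF char(1,2)]) (auto simp: U_def)
  qed
  then have "P \<in> U \<rightarrow> V" by blast
  from pigeonhole_card[OF this UV(1,2,5)] obtain v
    where v: "v \<in> V" "card (P -` {v} \<inter> U) * q ^ m \<ge> q ^ (m + h)"
    using UV by auto
  let ?W = "P -` {v} \<inter> U"
  let ?Z = "{x. (\<Sum>i<h. f i * x ^ (q ^ i)) = (\<Sum>k<m. w k * v k)}"
  have "inj_on G ?W"
  proof (rule inj_onI)
    fix u u' assume uu: "u \<in> ?W" "u' \<in> ?W" "G u = G u'"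
    then have "(\<Sum>j\<in>S. (u j - u' j) * \<gamma> j) = 0"
      by (simp add: G_def left_diff_distrib sum_subtractf)
    moreover have "u j - u' j \<in> ?F" if "j \<in> S" for j
      using uu that by (auto simp: U_def intro!: frob_fix_closed[OF char(1,2)])
    ultimately have "u j - u' j = 0" if "j \<in> S" for j
      using indep[of "\<lambda>j. u j - u' j" j] that by simp
    then show "u = u'" using uu by (auto simp: U_def intro: PiE_ext)
  qed
  moreover have "G ` ?W \<subseteq> ?Z"
  proof (intro image_subsetI CollectI)
    fix u assume u: "u \<in> ?W"
    then have uF: "u j \<in> ?F" if "j \<in> S" for j using that by (auto simp: U_def)
    \<comment> \<open>The power \<open>q ^ i\<close> is additive and fixes each \<open>u j\<close>,
      so it acts on the \<open>\<gamma> j\<close> alone.\<close>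
    have "G u ^ (q ^ i) = (\<Sum>j\<in>S. u j * \<gamma> j ^ (q ^ i))" for i
    proof -
      have "q ^ i = CHAR('a) ^ (s * i)" by (simp add: char(2) power_mult)
      then have "G u ^ (q ^ i) = (\<Sum>j\<in>S. (u j * \<gamma> j) ^ (q ^ i))"
        unfolding G_def by (rule freshmans_dream_sum'[OF char(1)])
      then show ?thesis using uF by (simp add: power_mult_distrib frob_fix_iterate)
    qed
    then have "(\<Sum>i<h. f i * G u ^ (q ^ i)) = (\<Sum>i<h. \<Sum>j\<in>S. u j * (f i * \<gamma> j ^ (q ^ i)))"
      by (simp add: sum_distrib_left mult_ac)
    also have "\<dots> = (\<Sum>j\<in>S. u j * (\<Sum>i<h. f i * \<gamma> j ^ (q ^ i)))"
      by (subst sum.swap) (simp add: sum_distrib_left)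
    also have "\<dots> = (\<Sum>j\<in>S. u j * (\<Sum>k<m. w k * A k j))" using rel by simp
    also have "\<dots> = (\<Sum>k<m. w k * (\<Sum>j\<in>S. u j * A k j))"
      by (simp add: sum_distrib_left mult_ac) (rule sum.swap)
    also have "\<dots> = (\<Sum>k<m. w k * v k)"
      using u by (auto simp: P_def intro!: sum.cong)
    finally show "(\<Sum>i<h. f i * G u ^ (q ^ i)) = (\<Sum>k<m. w k * v k)" .
  qed
  ultimately have "card ?W \<le> card ?Z"
    using card_linearized_fibre_le(1)[OF \<open>q \<ge> 2\<close> \<open>i0 < h\<close>, of f, OF nz] card_inj_on_le by blast
  also have "\<dots> \<le> q ^ (h - 1)" by (rule card_linearized_fibre_le(2)[OF \<open>q \<ge> 2\<close> \<open>i0 < h\<close>, of f, OF nz])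
  finally have "q ^ (m + h) \<le> q ^ (h - 1) * q ^ m"
    using v(2) by (meson le_trans mult_le_mono1)
  also have "\<dots> = q ^ (m + h - 1)" using \<open>i0 < h\<close> by (simp flip: power_add add: add.commute)
  also have "\<dots> < q ^ (m + h)" using \<open>q \<ge> 2\<close> \<open>i0 < h\<close> by (intro power_strict_increasing) auto
  finally show False by simp
qed

section \<open>Linear independence from eigenspaces and a basis of the large field\<close>

text \<open>Each \<open>b t * z t\<close> satisfies \<open>x ^ Q = \<nu> t * x\<close>, so it is
  zero or an eigenvector of the additive map \<open>x ^ Q\<close>. As for linear maps, eigenvectors
  for distinct eigenvalues are independent.\<close>

lemma scaled_sum_zero:
  fixes b \<nu> z :: "'b \<Rightarrow> 'a::field"
  assumes char: "prime CHAR('a)" "Q = CHAR('a) ^ k"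
    and "finite T" "inj_on \<nu> T"
    and "\<And>t. t \<in> T \<Longrightarrow> b t \<noteq> 0 \<and> \<nu> t \<in> frob_fix Q \<and> b t ^ Q = \<nu> t * b t"
    and "\<And>t. t \<in> T \<Longrightarrow> z t \<in> frob_fix Q"
    and "(\<Sum>t\<in>T. b t * z t) = 0" and "t \<in> T"
  shows "z t = 0"
  using assms(3-)
proof (induction T arbitrary: z t rule: finite_induct)
  case (insert s T)
  have sum0: "b s * z s + (\<Sum>t\<in>T. b t * z t) = 0"
    using insert by simp
  have "0 = (\<Sum>t\<in>insert s T. b t * z t) ^ Q"
    using insert.prems(4) char prime_gt_0_nat[OF char(1)] by (simp add: power_0_left)
  also have "\<dots> = (\<Sum>t\<in>insert s T. (b t * z t) ^ Q)"
    by (rule freshmans_dream_sum'[OF char])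
  also have "\<dots> = (\<Sum>t\<in>insert s T. \<nu> t * (b t * z t))"
    using insert.prems(2,3) by (intro sum.cong) (auto simp: power_mult_distrib frob_fix_def)
  finally have sum1: "\<nu> s * (b s * z s) + (\<Sum>t\<in>T. \<nu> t * (b t * z t)) = 0"
    using insert.hyps by simp
  \<comment> \<open>Subtracting \<open>\<nu> s\<close> times the relation from its image under
    Frobenius eliminates the term of \<open>s\<close>. The new coefficients stay in
    \<open>frob_fix Q\<close> because the eigenvalues lie there, so the induction hypothesis
    applies.\<close>
  have "(\<Sum>t\<in>T. b t * ((\<nu> t - \<nu> s) * z t)) =
      (\<nu> s * (b s * z s) + (\<Sum>t\<in>T. \<nu> t * (b t * z t))) - \<nu> s * (b s * z s + (\<Sum>t\<in>T. b t * z t))"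
    by (simp add: algebra_simps sum_subtractf sum_distrib_left)
  then have "(\<Sum>t\<in>T. b t * ((\<nu> t - \<nu> s) * z t)) = 0"
    using sum0 sum1 by simp
  moreover have "(\<nu> t - \<nu> s) * z t \<in> frob_fix Q" if "t \<in> T" for t
    using insert.prems(2,3) that by (intro frob_fix_closed[OF char]) auto
  ultimately have "(\<nu> t - \<nu> s) * z t = 0" if "t \<in> T" for t
    using insert.prems(1,2) that by (intro insert.IH[of "\<lambda>t. (\<nu> t - \<nu> s) * z t"]) simp_all
  moreover have "\<nu> t \<noteq> \<nu> s" if "t \<in> T" for t
    using inj_onD[OF insert.prems(1), of t s] insert.hyps(2) that by blast
  ultimately have zT: "z t = 0" if "t \<in> T" for t using that by auto
  then have "b s * z s = 0" using sum0 by simp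
  then have "z s = 0" using insert.prems(2) by simp
  then show ?case using zT insert.prems(5) by auto
qed simp

text \<open>Greedy choice: \<open>k < r\<close> vectors span at most \<open>q ^ k\<close> elements,
  fewer than the \<open>q ^ r\<close> available, so another independent one can be added. The
  general \<open>k \<le> r\<close> serves the induction; the basis is the case
  \<open>k = r\<close>.\<close>

lemma exists_indep_over_frob_fix:
  assumes char: "prime CHAR('a::alg_closed_field)" "q = CHAR('a) ^ s" "s > 0"
    and "k \<le> r"
  shows "\<exists>\<beta>::nat \<Rightarrow> 'a. (\<forall>j<k. \<beta> j \<in> frob_fix (q ^ r)) \<and>
    (\<forall>u. (\<forall>j<k. u j \<in> frob_fix q) \<longrightarrow> (\<Sum>j<k. u j * \<beta> j) = 0 \<longrightarrow> (\<forall>j<k. u j = 0))"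
  using \<open>k \<le> r\<close>
proof (induction k)
  case (Suc k)
  let ?F = "frob_fix q :: 'a set"
  let ?K = "frob_fix (q ^ r) :: 'a set"
  have Q: "q ^ r = CHAR('a) ^ (s * r)" by (simp add: char(2) power_mult)
  have F: "finite ?F" "card ?F = q" using card_frob_fix[OF char] by auto
  have K: "card ?K = q ^ r" using card_frob_fix[OF char(1) Q] char(3) Suc.prems by auto
  have "CHAR('a) > 1" using char(1) by (rule prime_gt_1_nat)
  then have "q > 1" using char(2,3) by (metis one_less_power)
  obtain \<beta> :: "nat \<Rightarrow> 'a" where \<beta>: "\<forall>j<k. \<beta> j \<in> ?K"
    "\<And>u. (\<forall>j<k. u j \<in> ?F) \<Longrightarrow> (\<Sum>j<k. u j * \<beta> j) = 0 \<Longrightarrow> (\<forall>j<k. u j = 0)"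
    using Suc.IH[OF Suc_leD[OF Suc.prems]] by auto
  let ?U = "PiE {..<k} (\<lambda>_. ?F)"
  let ?span = "(\<lambda>u. \<Sum>j<k. u j * \<beta> j) ` ?U"
  have "finite ?U" using F by (simp add: finite_PiE)
  have "card ?span \<le> card ?U" using \<open>finite ?U\<close> by (rule card_image_le)
  also have "\<dots> = q ^ k" using F by (simp add: card_PiE)
  also have "\<dots> < q ^ r" using \<open>q > 1\<close> Suc.prems by simp
  finally have "card ?span < card ?K" using K by simp
  then obtain x where x: "x \<in> ?K" "x \<notin> ?span"
    using card_mono[of ?span ?K] \<open>finite ?U\<close> by (meson finite_imageI leD subsetI)
  let ?\<beta> = "\<beta>(k := x)"
  have "\<forall>j<Suc k. u j = 0" if u: "\<forall>j<Suc k. u j \<in> ?F" "(\<Sum>j<Suc k. u j * ?\<beta> j) = 0" for u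
  proof -
    have "(\<Sum>j<k. u j * ?\<beta> j) = (\<Sum>j<k. u j * \<beta> j)" by (intro sum.cong) auto
    then have eq: "(\<Sum>j<k. u j * \<beta> j) + u k * x = 0" using u(2) by simp
    have "u k = 0"
    proof (rule ccontr)
      assume nz: "u k \<noteq> 0"
      \<comment> \<open>Solving the relation for \<open>x\<close> would put it into the span. The
        form \<open>0 - u j\<close> fits the closure of the subfield under differences.\<close>
      define u' where "u' = (\<lambda>j\<in>{..<k}. (0 - u j) * inverse (u k))"
      have "u' j \<in> ?F" if "j < k" for j
        unfolding u'_def using u(1) that frob_fix_closed[OF char(1,2)] by (simp del: diff_0)
      then have "u' \<in> ?U" by (auto simp: u'_def)
      have "x = - (\<Sum>j<k. u j * \<beta> j) * inverse (u k)"
        using eq nz by (simp add: field_simps eq_neg_iff_add_eq_0)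
      also have "\<dots> = (\<Sum>j<k. u' j * \<beta> j)"
        by (simp add: u'_def sum_distrib_left sum_distrib_right sum_negf mult_ac)
      finally show False using x(2) \<open>u' \<in> ?U\<close> by blast
    qed
    moreover from this have "\<forall>j<k. u j = 0" using eq u(1) by (intro \<beta>(2)) simp_all
    ultimately show ?thesis by (simp add: less_Suc_eq)
  qed
  moreover have "\<forall>j<Suc k. ?\<beta> j \<in> ?K" using \<beta>(1) x(1) by (auto simp: less_Suc_eq)
  ultimately show ?case by blast
qed auto

section \<open>Column independence from row independence\<close>

text \<open>The map sending row coefficients to their combination is an injection between finite sets of
  the same size, so every unit vector is a combination of the rows.\<close>
lemma columns_indep_if_rows_indep:
  fixes K :: "'a::field set" and H :: "nat \<Rightarrow> 'b \<Rightarrow> 'a"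
  assumes K: "finite K" "0 \<in> K" "1 \<in> K"
      "\<And>x y. x \<in> K \<Longrightarrow> y \<in> K \<Longrightarrow> x + y \<in> K"
      "\<And>x y. x \<in> K \<Longrightarrow> y \<in> K \<Longrightarrow> x - y \<in> K"
      "\<And>x y. x \<in> K \<Longrightarrow> y \<in> K \<Longrightarrow> x * y \<in> K"
    and S: "finite S" "card S = m"
    and H: "\<And>i j. i < m \<Longrightarrow> j \<in> S \<Longrightarrow> H i j \<in> K"
    and rows: "\<And>w i. (\<And>i. i < m \<Longrightarrow> w i \<in> K) \<Longrightarrow> (\<And>j. j \<in> S \<Longrightarrow> (\<Sum>i<m. w i * H i j) = 0) \<Longrightarrow>
      i < m \<Longrightarrow> w i = 0"
    and c: "\<And>i. i < m \<Longrightarrow> (\<Sum>j\<in>S. c j * H i j) = 0"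
    and "j0 \<in> S"
  shows "c j0 = 0"
proof -
  have sumK: "sum f A \<in> K" if "\<And>i. i \<in> A \<Longrightarrow> f i \<in> K" for f :: "nat \<Rightarrow> 'a" and A
    using that K by (induction A rule: infinite_finite_induct) auto
  let ?W = "PiE {..<m} (\<lambda>_. K)" and ?V = "PiE S (\<lambda>_. K)"
  define \<Phi> where "\<Phi> w = (\<lambda>j\<in>S. \<Sum>i<m. w i * H i j)" for w
  have fin: "finite ?W" "finite ?V" "card ?W = card ?V"
    using K S by (auto simp: finite_PiE card_PiE)
  have "\<Phi> ` ?W \<subseteq> ?V"
  proof (intro image_subsetI)
    fix w assume "w \<in> ?W"
    then have "w i * H i j \<in> K" if "i < m" "j \<in> S" for i j
      using that by (intro K(6) H) auto
    then show "\<Phi> w \<in> ?V" by (auto simp: \<Phi>_def intro!: sumK)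
  qed
  moreover have "inj_on \<Phi> ?W"
  proof (rule inj_onI)
    fix w w' assume ww: "w \<in> ?W" "w' \<in> ?W" "\<Phi> w = \<Phi> w'"
    have "(\<Sum>i<m. (w i - w' i) * H i j) = 0" if "j \<in> S" for j
      using fun_cong[OF ww(3), of j] that by (simp add: \<Phi>_def left_diff_distrib sum_subtractf)
    moreover have "w i - w' i \<in> K" if "i < m" for i
      using ww(1,2) that by (intro K(5)) auto
    ultimately have "w i - w' i = 0" if "i < m" for i
      using rows[of "\<lambda>i. w i - w' i" i] that by blast
    then show "w = w'" using ww by (auto intro: PiE_ext)
  qed
  ultimately have "\<Phi> ` ?W = ?V"
    using fin by (intro card_subset_eq) (auto simp: card_image)
  moreover have "(\<lambda>j\<in>S. if j = j0 then 1 else 0) \<in> ?V" using K by auto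
  ultimately obtain w where w0: "\<Phi> w = (\<lambda>j\<in>S. if j = j0 then 1 else 0)" by (metis (lifting) imageE)
  have w: "(\<Sum>i<m. w i * H i j) = (if j = j0 then 1 else 0)" if "j \<in> S" for j
    using fun_cong[OF w0, of j] that by (simp add: \<Phi>_def)
  \<comment> \<open>Pairing \<open>c\<close> with the unit vector at \<open>j0\<close>, written as a
    combination of the rows, isolates \<open>c j0\<close>; after swapping the sums every row
    contributes zero.\<close>
  have "c j0 = (\<Sum>j\<in>S. c j * (if j = j0 then 1 else 0))"
    using S \<open>j0 \<in> S\<close> by (simp add: if_distrib cong: if_cong)
  also have "\<dots> = (\<Sum>j\<in>S. c j * (\<Sum>i<m. w i * H i j))" using w by simp
  also have "\<dots> = (\<Sum>i<m. w i * (\<Sum>j\<in>S. c j * H i j))"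
    by (simp add: sum_distrib_left mult_ac) (rule sum.swap)
  also have "\<dots> = 0" using c by simp
  finally show ?thesis .
qed

section \<open>Transport of a subfield to a HOL-Algebra ring\<close>

text \<open>The computations take place in a subset \<open>K\<close> of a type-class field, whereas
  the theorem asks for a record with a carrier in \<open>nat\<close>. The injection
  \<open>\<phi>\<close> carries the structure over, and the facts below reduce statements about the
  copy to ordinary arithmetic in \<open>K\<close>.\<close>

locale subfield_copy =
  fixes K :: "'a::field set" and \<phi> :: "'a \<Rightarrow> 'b"
  assumes zero: "0 \<in> K" and one: "1 \<in> K"
    and add: "x \<in> K \<Longrightarrow> y \<in> K \<Longrightarrow> x + y \<in> K"
    and diff: "x \<in> K \<Longrightarrow> y \<in> K \<Longrightarrow> x - y \<in> K"
    and mult: "x \<in> K \<Longrightarrow> y \<in> K \<Longrightarrow> x * y \<in> K"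
    and inverse: "x \<in> K \<Longrightarrow> inverse x \<in> K"
    and inj: "inj_on \<phi> K"
begin

definition ring_copy :: "'b ring" where
  "ring_copy = image_ring \<phi>
     \<lparr>carrier = K, monoid.mult = (*), one = 1, ring.zero = 0, add = (+)\<rparr>"

lemma field_ring_copy: "field ring_copy"
proof -
  let ?R = "\<lparr>carrier = K, monoid.mult = (*), one = 1, ring.zero = 0, add = (+)\<rparr>"
  have neg: "\<exists>y\<in>K. x + y = 0" if "x \<in> K" for x
    using diff[OF zero that] by (intro bexI[of _ "0 - x"]) auto
  have inv: "\<exists>y\<in>K. x * y = 1" if "x \<in> K" "x \<noteq> 0" for x
    using inverse[OF that(1)] that(2) by (intro bexI[of _ "inverse x"]) auto
  have "field ?R"
    using neg inv
    by unfold_locales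
      (auto simp: Units_def algebra_simps zero one add mult)
  then interpret R: field ?R .
  show ?thesis unfolding ring_copy_def by (rule R.inj_imp_image_ring_is_field) (simp add: inj)
qed

lemma carrier_ring_copy: "carrier ring_copy = \<phi> ` K"
  by (simp add: ring_copy_def image_ring_carrier)

lemma zero_ring_copy: "\<zero>\<^bsub>ring_copy\<^esub> = \<phi> 0"
  by (simp add: ring_copy_def image_ring_zero)

lemma add_ring_copy: "x \<in> K \<Longrightarrow> y \<in> K \<Longrightarrow> \<phi> x \<oplus>\<^bsub>ring_copy\<^esub> \<phi> y = \<phi> (x + y)"
  by (simp add: ring_copy_def image_ring_def image_group_def monoid.defs inj)

lemma mult_ring_copy: "x \<in> K \<Longrightarrow> y \<in> K \<Longrightarrow> \<phi> x \<otimes>\<^bsub>ring_copy\<^esub> \<phi> y = \<phi> (x * y)"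
  by (simp add: ring_copy_def image_ring_def image_group_def monoid.defs inj)

lemma copy_eq_zero_iff: "x \<in> K \<Longrightarrow> \<phi> x = \<zero>\<^bsub>ring_copy\<^esub> \<longleftrightarrow> x = 0"
  using inj zero by (auto simp: zero_ring_copy inj_on_def)

lemma sum_closed: "(\<And>i. i \<in> A \<Longrightarrow> y i \<in> K) \<Longrightarrow> sum y A \<in> K"
  by (induction A rule: infinite_finite_induct) (auto simp: zero add)

lemma power_closed: "x \<in> K \<Longrightarrow> x ^ i \<in> K"
  by (induction i) (auto simp: one mult)

lemma finsum_ring_copy:
  assumes "finite A" "\<And>i. i \<in> A \<Longrightarrow> x i = \<phi> (y i)" "\<And>i. i \<in> A \<Longrightarrow> y i \<in> K"
  shows "finsum ring_copy x A = \<phi> (sum y A)"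
proof -
  interpret F: field ring_copy by (rule field_ring_copy)
  show ?thesis using assms
  proof (induction A rule: finite_induct)
    case (insert i A)
    have "finsum ring_copy x (insert i A) = x i \<oplus>\<^bsub>ring_copy\<^esub> finsum ring_copy x A"
      using insert by (intro F.finsum_insert) (auto simp: carrier_ring_copy)
    then show ?case using insert by (simp add: add_ring_copy sum_closed)
  qed (simp add: zero_ring_copy)
qed

lemma cols_indep_ring_copy:
  assumes "finite S" and H: "\<And>i j. i < m \<Longrightarrow> j \<in> S \<Longrightarrow> H i j \<in> K"
    and indep: "\<And>c j. (\<And>j. j \<in> S \<Longrightarrow> c j \<in> K) \<Longrightarrow>
      (\<And>i. i < m \<Longrightarrow> (\<Sum>j\<in>S. c j * H i j) = 0) \<Longrightarrow> j \<in> S \<Longrightarrow> c j = 0"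
  shows "cols_indep ring_copy m (\<lambda>i j. \<phi> (H i j)) S"
  unfolding cols_indep_def
proof (intro allI impI ballI)
  fix c j
  assume c: "\<forall>j\<in>S. c j \<in> carrier ring_copy"
    and z: "\<forall>i<m. (\<Oplus>\<^bsub>ring_copy\<^esub>j\<in>S. c j \<otimes>\<^bsub>ring_copy\<^esub> \<phi> (H i j)) = \<zero>\<^bsub>ring_copy\<^esub>"
    and "j \<in> S"
  define d where "d j = inv_into K \<phi> (c j)" for j
  have d: "d j \<in> K" "c j = \<phi> (d j)" if "j \<in> S" for j
    using c that by (auto simp: d_def carrier_ring_copy inv_into_into f_inv_into_f)
  have "(\<Sum>j\<in>S. d j * H i j) = 0" if "i < m" for i
  proof -
    have "(\<Oplus>\<^bsub>ring_copy\<^esub>j\<in>S. c j \<otimes>\<^bsub>ring_copy\<^esub> \<phi> (H i j)) = \<phi> (\<Sum>j\<in>S. d j * H i j)"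
      using that d H by (intro finsum_ring_copy \<open>finite S\<close>) (auto simp: mult_ring_copy mult)
    then have "\<phi> (\<Sum>j\<in>S. d j * H i j) = \<zero>\<^bsub>ring_copy\<^esub>" using z that by simp
    moreover have "(\<Sum>j\<in>S. d j * H i j) \<in> K" using that d H by (intro sum_closed mult) auto
    ultimately show ?thesis using copy_eq_zero_iff by blast
  qed
  then have "d j = 0" using indep[of d j] d(1) \<open>j \<in> S\<close> by blast
  then show "c j = \<zero>\<^bsub>ring_copy\<^esub>" using d \<open>j \<in> S\<close> by (simp add: zero_ring_copy)
qed

section \<open>Vandermonde blocks as Reed-Solomon codes\<close>

text \<open>A message is read as the coefficient vector of a polynomial, so that a Vandermonde
  column evaluates it.\<close>

lemma codeword_vandermonde:
  assumes "degree p < a" "\<And>i. Polynomial.coeff p i \<in> K" "x \<in> K"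
    and "\<And>i. i < a \<Longrightarrow> u i = \<phi> (Polynomial.coeff p i)" "\<And>i. i < a \<Longrightarrow> A i j = \<phi> (x ^ i)"
  shows "codeword ring_copy a A u j = \<phi> (poly p x)"
proof -
  have "codeword ring_copy a A u j = \<phi> (\<Sum>i<a. Polynomial.coeff p i * x ^ i)"
    unfolding codeword_def using assms
    by (intro finsum_ring_copy) (auto simp: mult_ring_copy mult power_closed)
  also have "(\<Sum>i<a. Polynomial.coeff p i * x ^ i) = poly p x"
    unfolding poly_altdef using assms(1)
    by (intro sum.mono_neutral_right) (auto simp: coeff_eq_0)
  finally show ?thesis .
qed

text \<open>Ensures that the polynomial giving a codeword of minimum weight is a message over
  \<open>K\<close>.\<close>

lemma coeff_prod_linear_closed:
  "finite J \<Longrightarrow> (\<And>j. j \<in> J \<Longrightarrow> \<alpha> j \<in> K) \<Longrightarrow> Polynomial.coeff (\<Prod>j\<in>J. [:- \<alpha> j, 1:]) i \<in> K"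
proof (induction J arbitrary: i rule: finite_induct)
  case (insert j J)
  have IH: "Polynomial.coeff (\<Prod>j\<in>J. [:- \<alpha> j, 1:]) i \<in> K" for i
    using insert by simp
  let ?p = "\<Prod>j\<in>J. [:- \<alpha> j, 1:]"
  have "Polynomial.coeff ([:- \<alpha> j, 1:] * ?p) i =
      (case i of 0 \<Rightarrow> 0 | Suc l \<Rightarrow> Polynomial.coeff ?p l) - \<alpha> j * Polynomial.coeff ?p i"
    by (simp add: coeff_pCons)
  also have "\<dots> \<in> K"
    using IH insert.prems by (intro diff mult) (auto simp: zero split: nat.split)
  finally show ?case using insert.hyps by simp
qed (auto simp: zero one coeff_pCons split: nat.split)

text \<open>A nonzero polynomial of degree below \<open>a\<close> vanishes at no more than
  \<open>a - 1\<close> of the \<open>r\<close> distinct points, which gives both injectivity of the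
  encoding and the distance bound. A product of \<open>a - 1\<close> linear factors attains the
  bound.\<close>

lemma generates_code_vandermonde:
  assumes "0 < a" "a \<le> r"
    and \<alpha>: "\<And>j. j < r \<Longrightarrow> \<alpha> j \<in> K" "inj_on \<alpha> {..<r}"
    and A: "\<And>i j. i < a \<Longrightarrow> j < r \<Longrightarrow> A i j = \<phi> (\<alpha> j ^ i)"
  shows "generates_code ring_copy r a (r - a + 1) A"
proof -
  have polyK: "poly p (\<alpha> j) \<in> K" if "j < r" "\<And>i. Polynomial.coeff p i \<in> K" for p j
    unfolding poly_altdef using that \<alpha> by (auto intro!: sum_closed mult power_closed)
  have cw: "codeword ring_copy a A u j = \<phi> (poly p (\<alpha> j))"
    if "degree p < a" "\<And>i. Polynomial.coeff p i \<in> K" "j < r" "\<And>i. i < a \<Longrightarrow> u i = \<phi> (Polynomial.coeff p i)"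
    for p u j
    using that \<alpha>(1) A by (intro codeword_vandermonde) auto
  have wt: "hweight ring_copy r (codeword ring_copy a A u) = card {j. j < r \<and> poly p (\<alpha> j) \<noteq> 0}"
    if pu: "degree p < a" "\<And>i. Polynomial.coeff p i \<in> K" "\<And>i. i < a \<Longrightarrow> u i = \<phi> (Polynomial.coeff p i)" for p u
  proof -
    have "codeword ring_copy a A u j = \<zero>\<^bsub>ring_copy\<^esub> \<longleftrightarrow> poly p (\<alpha> j) = 0" if "j < r" for j
      using cw[OF pu(1,2) that pu(3)] copy_eq_zero_iff[OF polyK[OF that pu(2)]] by simp
    then show ?thesis unfolding hweight_def by (intro arg_cong[of _ _ card]) auto
  qed
  have roots: "card {j. j < r \<and> poly p (\<alpha> j) \<noteq> 0} \<ge> r - a + 1" if p: "p \<noteq> 0" "degree p < a" for p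
  proof -
    let ?Z = "{j. j < r \<and> poly p (\<alpha> j) = 0}"
    have "card ?Z = card (\<alpha> ` ?Z)"
      by (intro card_image[symmetric] inj_on_subset[OF \<alpha>(2)]) auto
    also have "\<dots> \<le> card {x. poly p x = 0}"
      using poly_roots_finite[OF p(1)] by (intro card_mono) auto
    also have "\<dots> \<le> degree p" by (rule card_poly_roots_bound[OF p(1)])
    finally have "card ?Z < a" using p(2) by simp
    moreover have "{j. j < r \<and> poly p (\<alpha> j) \<noteq> 0} = {..<r} - ?Z" by auto
    moreover have "card ({..<r} - ?Z) = r - card ?Z" by (subst card_Diff_subset) auto
    ultimately show ?thesis using \<open>a \<le> r\<close> by simp
  qed
  have ex: "\<exists>p. degree p < a \<and> (\<forall>i. Polynomial.coeff p i \<in> K) \<and> (\<forall>i<a. u i = \<phi> (Polynomial.coeff p i))"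
    if u: "\<forall>i<a. u i \<in> carrier ring_copy" for u
  proof -
    define p where "p = (\<Sum>i<a. Polynomial.monom (inv_into K \<phi> (u i)) i)"
    have "Polynomial.coeff p i = (\<Sum>l<a. if l = i then inv_into K \<phi> (u i) else 0)" for i
      unfolding p_def coeff_sum by (intro sum.cong) auto
    then have c: "Polynomial.coeff p i = (if i < a then inv_into K \<phi> (u i) else 0)" for i
      by simp
    have "degree p < a"
      using \<open>0 < a\<close> by (intro degree_lessI) (auto simp: c)
    moreover have "Polynomial.coeff p i \<in> K" for i
      using u by (auto simp: c zero carrier_ring_copy inv_into_into)
    moreover have "\<forall>i<a. u i = \<phi> (Polynomial.coeff p i)"
      using u by (auto simp: c carrier_ring_copy f_inv_into_f)
    ultimately show ?thesis by blast
  qed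
  show ?thesis
    unfolding generates_code_def
  proof (intro conjI allI impI)
    show "A i j \<in> carrier ring_copy" if "i < a" "j < r" for i j
      using that A \<alpha> by (auto simp: carrier_ring_copy power_closed)
  next
    fix u i assume u: "\<forall>i<a. u i \<in> carrier ring_copy"
      and z: "\<forall>j<r. codeword ring_copy a A u j = \<zero>\<^bsub>ring_copy\<^esub>" and "i < a"
    from ex[OF u] obtain p where p: "degree p < a" "\<And>i. Polynomial.coeff p i \<in> K"
      "\<And>i. i < a \<Longrightarrow> u i = \<phi> (Polynomial.coeff p i)" by auto
    have "poly p (\<alpha> j) = 0" if "j < r" for j
      using z that cw[OF p(1,2) that p(3)] copy_eq_zero_iff[OF polyK[OF that p(2)]] by simp
    then have "{j. j < r \<and> poly p (\<alpha> j) \<noteq> 0} = {}" by auto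
    then have "p = 0" using roots[OF _ p(1)] by (metis card.empty add_is_0 le_zero_eq one_neq_zero)
    then show "u i = \<zero>\<^bsub>ring_copy\<^esub>" using p(3) \<open>i < a\<close> by (simp add: zero_ring_copy)
  next
    fix u assume u: "\<forall>i<a. u i \<in> carrier ring_copy"
      and pos: "0 < hweight ring_copy r (codeword ring_copy a A u)"
    from ex[OF u] obtain p where p: "degree p < a" "\<And>i. Polynomial.coeff p i \<in> K"
      "\<And>i. i < a \<Longrightarrow> u i = \<phi> (Polynomial.coeff p i)" by auto
    have "p \<noteq> 0" using pos wt[OF p] by auto
    then show "r - a + 1 \<le> hweight ring_copy r (codeword ring_copy a A u)"
      using roots[OF _ p(1)] wt[OF p] by simp
  next
    \<comment> \<open>This polynomial vanishes at exactly the first \<open>a - 1\<close> evaluation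
      points, leaving weight \<open>r - (a - 1)\<close>.\<close>
    define p where "p = (\<Prod>j<a - 1. [:- \<alpha> j, 1:])"
    define u where "u i = \<phi> (Polynomial.coeff p i)" for i
    have cK: "Polynomial.coeff p i \<in> K" for i
      unfolding p_def using \<alpha>(1) \<open>a \<le> r\<close> by (intro coeff_prod_linear_closed) auto
    have "degree p = a - 1" unfolding p_def by (subst degree_prod_eq_sum_degree) auto
    then have deg: "degree p < a" using \<open>0 < a\<close> by simp
    have "poly p (\<alpha> j) \<noteq> 0 \<longleftrightarrow> a - 1 \<le> j" if "j < r" for j
    proof -
      have "\<alpha> j = \<alpha> l \<longleftrightarrow> j = l" if "l < a - 1" for l
        using inj_on_eq_iff[OF \<alpha>(2), of j l] that \<open>j < r\<close> \<open>a \<le> r\<close> by simp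
      then show ?thesis by (auto simp: p_def poly_prod not_le)
    qed
    then have "j \<in> {j. j < r \<and> poly p (\<alpha> j) \<noteq> 0} \<longleftrightarrow> j \<in> {a - 1..<r}" for j
      by (cases "j < r") simp_all
    then have "{j. j < r \<and> poly p (\<alpha> j) \<noteq> 0} = {a - 1..<r}" by blast
    then have "hweight ring_copy r (codeword ring_copy a A u) = r - (a - 1)"
      using wt[OF deg cK, of u] by (simp add: u_def)
    also have "\<dots> = r - a + 1" using \<open>0 < a\<close> \<open>a \<le> r\<close> by simp
    finally show "\<exists>u. (\<forall>i<a. u i \<in> carrier ring_copy) \<and>
        0 < hweight ring_copy r (codeword ring_copy a A u) \<and>
        hweight ring_copy r (codeword ring_copy a A u) = r - a + 1"
      using cK by (intro exI[of _ u]) (auto simp: u_def carrier_ring_copy)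
  qed
qed

end

section \<open>The parity-check matrix and its verification\<close>

text \<open>Independence in two stages: collecting the coefficients of group \<open>t\<close> into
  \<open>z t\<close>, an element of the large field, \<open>scaled_sum_zero\<close> gives
  \<open>z t = 0\<close>; then independence of the \<open>\<beta> l\<close> over the small field
  kills the individual coefficients.\<close>

lemma scaled_basis_indep:
  fixes b \<nu> \<beta> :: "nat \<Rightarrow> 'a::field"
  assumes char: "prime CHAR('a)" "q = CHAR('a) ^ s"
    and \<nu>: "inj_on \<nu> {..<g}"
    and b: "\<And>t. t < g \<Longrightarrow> b t \<noteq> 0 \<and> \<nu> t \<in> frob_fix (q ^ r) \<and> b t ^ (q ^ r) = \<nu> t * b t"
    and \<beta>: "\<And>l. l < r \<Longrightarrow> \<beta> l \<in> frob_fix (q ^ r)"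
      "\<And>u. (\<forall>l<r. u l \<in> frob_fix q) \<Longrightarrow> (\<Sum>l<r. u l * \<beta> l) = 0 \<Longrightarrow> \<forall>l<r. u l = 0"
    and u: "\<And>j. j < g * r \<Longrightarrow> u j \<in> frob_fix q"
      "(\<Sum>j<g * r. u j * (b (j div r) * \<beta> (j mod r))) = 0"
    and "j < g * r"
  shows "u j = 0"
proof -
  have Q: "q ^ r = CHAR('a) ^ (s * r)" by (simp add: char(2) power_mult)
  define z where "z t = (\<Sum>l<r. u (t * r + l) * \<beta> l)" for t
  have idx: "t * r + l < g * r" if "t < g" "l < r" for t l
  proof -
    have "t * r + l < Suc t * r" using that by simp
    also have "\<dots> \<le> g * r" using that by (intro mult_le_mono1) simp
    finally show ?thesis .
  qed
  have "z t \<in> frob_fix (q ^ r)" if "t < g" for t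
    unfolding z_def
  proof (intro frob_fix_sum[OF char(1) Q] frob_fix_closed(5)[OF char(1) Q])
    fix l assume "l \<in> {..<r}"
    then show "\<beta> l \<in> frob_fix (q ^ r)" using \<beta> by simp
    have "u (t * r + l) \<in> frob_fix q" using u(1) idx that \<open>l \<in> {..<r}\<close> by simp
    then show "u (t * r + l) \<in> frob_fix (q ^ r)"
      using frob_fix_iterate by (auto simp: frob_fix_def)
  qed
  moreover have "(\<Sum>t<g. b t * z t) = 0"
  proof -
    have "0 = (\<Sum>t<g. \<Sum>j\<in>{t * r..<t * r + r}. u j * (b (j div r) * \<beta> (j mod r)))"
      by (subst sum.nat_group) (simp add: u(2))
    also have "\<dots> = (\<Sum>t<g. b t * z t)"
    proof (intro sum.cong refl)
      fix t
      have "(\<Sum>j\<in>{t * r..<t * r + r}. u j * (b (j div r) * \<beta> (j mod r))) =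
          (\<Sum>l<r. u (t * r + l) * (b ((t * r + l) div r) * \<beta> ((t * r + l) mod r)))"
        by (intro sum.reindex_bij_witness[of _ "\<lambda>l. t * r + l" "\<lambda>j. j - t * r"]) auto
      also have "\<dots> = b t * z t"
        unfolding z_def sum_distrib_left by (intro sum.cong) auto
      finally show "(\<Sum>j\<in>{t * r..<t * r + r}. u j * (b (j div r) * \<beta> (j mod r))) = b t * z t" .
    qed
    finally show ?thesis by simp
  qed
  ultimately have z0: "z t = 0" if "t < g" for t
    using that b by (intro scaled_sum_zero[OF char(1) Q _ \<nu>, of b z]) auto
  have "r > 0" using \<open>j < g * r\<close> by (cases r) auto
  then have "j div r < g" "j mod r < r"
    using \<open>j < g * r\<close> by (auto simp: less_mult_imp_div_less)
  moreover from this have "\<forall>l<r. u ((j div r) * r + l) = 0"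
    using z0 u(1) idx by (intro \<beta>(2)) (auto simp: z_def)
  ultimately have "u ((j div r) * r + j mod r) = 0" by blast
  then show ?thesis by simp
qed

text \<open>There is one group for each nonzero element of the field with \<open>q\<close> elements,
  hence \<open>q - 1\<close> groups. The condition \<open>r \<le> q\<close> supplies
  \<open>r\<close> distinct evaluation points, and all groups share them.\<close>

lemma MR_LRC_matrix_exists:
  fixes \<phi> :: "'a::alg_closed_field \<Rightarrow> 'b"
  assumes char: "prime CHAR('a)" "q = CHAR('a) ^ s" "s > 0"
    and "0 < a" "a \<le> r" "r \<le> q"
    and inj: "inj_on \<phi> (frob_fix (q ^ r))"
  shows "\<exists>H. MR_LRC_matrix (subfield_copy.ring_copy (frob_fix (q ^ r)) \<phi>) ((q - 1) * r) r h a H"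
proof -
  let ?K = "frob_fix (q ^ r) :: 'a set" and ?F = "frob_fix q :: 'a set"
  define g where "g = q - 1"
  have Q: "q ^ r = CHAR('a) ^ (s * r)" by (simp add: char(2) power_mult)
  have "r > 0" using assms by simp
  interpret subfield_copy ?K \<phi>
    by unfold_locales (use inj in \<open>auto intro: frob_fix_closed[OF char(1) Q]\<close>)
  have F: "finite ?F" "card ?F = q" using card_frob_fix[OF char] by auto
  have finK: "finite ?K" using card_frob_fix(1)[OF char(1) Q] \<open>s > 0\<close> \<open>r > 0\<close> by simp
  have FK: "x \<in> ?K" if "x \<in> ?F" for x
    using frob_fix_iterate[OF that, of r] by (simp add: frob_fix_def)
  have "CHAR('a) > 1" using char(1) by (rule prime_gt_1_nat)
  then have "q > 1" using char(2,3) by (metis one_less_power)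
  then have "q ^ r > 1" using \<open>r > 0\<close> by (metis one_less_power)
  obtain \<alpha> where "bij_betw \<alpha> {0..<q} ?F"
    using ex_bij_betw_nat_finite[OF F(1)] F(2) by auto
  then have \<alpha>: "inj_on \<alpha> {..<r}" "\<And>j. j < r \<Longrightarrow> \<alpha> j \<in> ?F"
    using \<open>r \<le> q\<close> by (auto simp: bij_betw_def atLeast0LessThan intro: inj_on_subset)
  have "card (?F - {0}) = g"
    using F frob_fix_closed(1)[OF char(1,2)] by (simp add: g_def)
  then obtain \<nu> where "bij_betw \<nu> {0..<g} (?F - {0})"
    using ex_bij_betw_nat_finite[of "?F - {0}"] F(1) by auto
  then have \<nu>: "inj_on \<nu> {..<g}" "\<And>t. t < g \<Longrightarrow> \<nu> t \<in> ?F \<and> \<nu> t \<noteq> 0"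
    by (auto simp: bij_betw_def atLeast0LessThan)
  have "\<exists>b. \<forall>t. b t ^ (q ^ r - 1) = \<nu> t"
    using \<open>q ^ r > 1\<close> by (intro choice allI nth_root_exists) simp
  then obtain b where b: "\<And>t. b t ^ (q ^ r - 1) = \<nu> t" by blast
  have b0: "b t \<noteq> 0" if "t < g" for t
  proof
    assume "b t = 0"
    then have "\<nu> t = 0" using b[of t] \<open>q ^ r > 1\<close> by (simp add: power_0_left)
    then show False using \<nu>(2)[OF that] by simp
  qed
  have bQ: "b t ^ (q ^ r) = \<nu> t * b t" for t
    unfolding b[of t, symmetric] using \<open>q ^ r > 1\<close> by (intro power_minus_mult[symmetric]) linarith
  obtain \<beta> :: "nat \<Rightarrow> 'a" where \<beta>: "\<And>l. l < r \<Longrightarrow> \<beta> l \<in> ?K"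
      "\<And>u. (\<forall>l<r. u l \<in> ?F) \<Longrightarrow> (\<Sum>l<r. u l * \<beta> l) = 0 \<Longrightarrow> \<forall>l<r. u l = 0"
    using exists_indep_over_frob_fix[OF char order_refl, of r] by auto
  \<comment> \<open>For \<open>\<nu> t \<noteq> 1\<close> the element \<open>b t\<close> is not in
    \<open>?K\<close>: the power \<open>q ^ r\<close> multiplies it by \<open>\<nu> t\<close>. It
    therefore multiplies \<open>b t ^ (q ^ i - 1)\<close> by \<open>\<nu> t ^ (q ^ i - 1)\<close>,
    which is 1.\<close>
  have bK: "b t ^ (q ^ i - 1) \<in> ?K" if "t < g" for t i
  proof -
    have "\<nu> t ^ (q ^ i - 1) * \<nu> t = \<nu> t"
      using frob_fix_iterate[of "\<nu> t" q i] \<nu>(2)[OF that] power_minus_mult[of "q ^ i" "\<nu> t"] \<open>q > 1\<close>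
      by simp
    then have "\<nu> t ^ (q ^ i - 1) = 1" using \<nu>(2)[OF that] by simp
    have "(b t ^ (q ^ i - 1)) ^ (q ^ r) = (b t ^ (q ^ r)) ^ (q ^ i - 1)"
      by (simp flip: power_mult add: mult.commute)
    also have "\<dots> = b t ^ (q ^ i - 1)"
      using \<open>\<nu> t ^ (q ^ i - 1) = 1\<close> by (simp add: bQ power_mult_distrib)
    finally show ?thesis by (simp add: frob_fix_def)
  qed
  define \<gamma> where "\<gamma> j = b (j div r) * \<beta> (j mod r)" for j
  \<comment> \<open>Local row \<open>i\<close> belongs to group \<open>i div a\<close> and carries
    the exponent \<open>i mod a\<close>. A global row is \<open>\<gamma> j ^ (q ^ i)\<close> divided
    by \<open>b (j div r)\<close>, with the quotient expanded so that its entries visibly lie in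
    \<open>?K\<close>.\<close>
  define H where "H i j = (if i < g * a then if j div r = i div a then \<alpha> (j mod r) ^ (i mod a) else 0
      else \<beta> (j mod r) ^ (q ^ (i - g * a)) * b (j div r) ^ (q ^ (i - g * a) - 1))" for i j
  have jr: "j div r < g" "j mod r < r" if "j < g * r" for j
    using that \<open>r > 0\<close> by (auto simp: less_mult_imp_div_less)
  have HF: "H i j \<in> ?F" if "i < g * a" "j < g * r" for i j
    using that jr[OF that(2)] \<alpha>(2) frob_fix_closed(1)[OF char(1,2)]
    by (auto simp: H_def intro: frob_fix_power)
  have HK: "H i j \<in> ?K" if "j < g * r" for i j
  proof (cases "i < g * a")
    case False
    then have "H i j = \<beta> (j mod r) ^ (q ^ (i - g * a)) * b (j div r) ^ (q ^ (i - g * a) - 1)"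
      by (simp add: H_def)
    also have "\<dots> \<in> ?K" using jr[OF that] by (intro mult frob_fix_power[OF \<beta>(1)] bK)
    finally show ?thesis .
  qed (use HF FK that in blast)
  have "cols_indep ring_copy (g * a + h) (\<lambda>i j. \<phi> (H i j)) S"
    if S: "S \<subseteq> {..<g * r}" "card S = g * a + h" "\<And>t. t < g \<Longrightarrow> card {j\<in>S. j div r = t} \<ge> a" for S
  proof (rule cols_indep_ring_copy)
    show "finite S" using S(1) finite_subset by blast
    show "H i j \<in> ?K" if "j \<in> S" for i j using HK S(1) that by auto
  next
    fix c j0
    assume c: "\<And>i. i < g * a + h \<Longrightarrow> (\<Sum>j\<in>S. c j * H i j) = 0" and "j0 \<in> S"
    have finS: "finite S" using S(1) finite_subset by blast
    show "c j0 = 0"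
    \<comment> \<open>The columns in \<open>S\<close> form a square matrix, so it suffices to show
      that its rows are independent.\<close>
    proof (rule columns_indep_if_rows_indep[OF finK zero one add diff mult finS S(2) _ _ c \<open>j0 \<in> S\<close>])
      show "H i j \<in> ?K" if "j \<in> S" for i j using HK S(1) that by auto
      fix w i0
      assume w: "\<And>j. j \<in> S \<Longrightarrow> (\<Sum>i<g * a + h. w i * H i j) = 0" and i0: "i0 < g * a + h"
      have split: "(\<Sum>i<g * a. w i * H i j) + (\<Sum>i<h. w (g * a + i) * H (g * a + i) j) = 0"
        if "j \<in> S" for j
      proof -
        have "(\<Sum>i<m + l. f i) = (\<Sum>i<m. f i) + (\<Sum>i<l. f (m + i))" for f :: "nat \<Rightarrow> 'a" and m l
          by (induction l) (simp_all add: add.assoc)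
        then show ?thesis using w[OF that] by simp
      qed
      have global: "w (g * a + i) = 0" if "i < h" for i
      \<comment> \<open>Undoing the division by \<open>b (j div r)\<close> multiplies local row
        \<open>k\<close> by \<open>b (k div a)\<close>: the two factors agree wherever that row has
        a nonzero entry.\<close>
      proof (rule linearized_combination_zero[OF char finS S(2), where \<gamma> = \<gamma> and A = H
            and w = "\<lambda>k. - w k * b (k div a)" and f = "\<lambda>i. w (g * a + i)"])
        fix u j assume u: "\<And>j. j \<in> S \<Longrightarrow> u j \<in> ?F" "(\<Sum>j\<in>S. u j * \<gamma> j) = 0" and "j \<in> S"
        \<comment> \<open>Extension by zero to all columns makes \<open>scaled_basis_indep\<close>
          applicable.\<close>
        define u' where "u' j = (if j \<in> S then u j else 0)" for j
        have "(\<Sum>j<g * r. u' j * \<gamma> j) = (\<Sum>j\<in>S. u' j * \<gamma> j)"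
          using S(1) by (intro sum.mono_neutral_right) (auto simp: u'_def)
        also have "\<dots> = 0" using u(2) by (simp add: u'_def)
        finally have "u' j = 0"
          using \<open>j \<in> S\<close> S(1) u(1) \<nu> b0 bQ \<beta> FK frob_fix_closed(1)[OF char(1,2)]
          by (intro scaled_basis_indep[OF char(1,2) \<nu>(1), of b r \<beta> u' j]) (auto simp: u'_def \<gamma>_def)
        then show "u j = 0" using \<open>j \<in> S\<close> by (simp add: u'_def)
      next
        show "H k j \<in> ?F" if "k < g * a" "j \<in> S" for k j using HF S(1) that by auto
      next
        fix j assume "j \<in> S"
        have scale: "\<gamma> j ^ (q ^ i) = b (j div r) * H (g * a + i) j" for i
        proof -
          have "b (j div r) ^ (q ^ i) = b (j div r) * b (j div r) ^ (q ^ i - 1)"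
            using \<open>q > 1\<close> power_minus_mult[of "q ^ i" "b (j div r)"] by (simp add: mult.commute)
          then show ?thesis by (simp add: \<gamma>_def H_def power_mult_distrib)
        qed
        have "(\<Sum>i<h. w (g * a + i) * \<gamma> j ^ (q ^ i)) =
            b (j div r) * (\<Sum>i<h. w (g * a + i) * H (g * a + i) j)"
          by (simp add: scale sum_distrib_left mult_ac)
        also have "\<dots> = b (j div r) * - (\<Sum>i<g * a. w i * H i j)"
          using split[OF \<open>j \<in> S\<close>] by (simp add: add_eq_0_iff)
        also have "\<dots> = (\<Sum>k<g * a. - w k * b (k div a) * H k j)"
          unfolding sum_negf[symmetric] sum_distrib_left by (intro sum.cong) (auto simp: H_def)
        finally show "(\<Sum>i<h. w (g * a + i) * \<gamma> j ^ (q ^ i)) =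
            (\<Sum>k<g * a. - w k * b (k div a) * H k j)" .
      qed (rule that)
      \<comment> \<open>With the global coefficients gone, those of block \<open>t\<close> define a
        polynomial of degree below \<open>a\<close>. It vanishes at the points of the columns of
        \<open>S\<close> in group \<open>t\<close>, of which there are at least
        \<open>a\<close>.\<close>
      have "w (t * a + i) = 0" if "t < g" "i < a" for t i
      proof -
        define p where "p = (\<Sum>i<a. Polynomial.monom (w (t * a + i)) i)"
        let ?J = "{j\<in>S. j div r = t}"
        have "t * a + a \<le> g * a" using \<open>t < g\<close> mult_le_mono1[of "Suc t" g a] by simp
        have root: "poly p (\<alpha> (j mod r)) = 0" if "j \<in> ?J" for j
        proof -
          have "0 = (\<Sum>i<g * a. w i * H i j)" using split global that by simp
          also have "\<dots> = (\<Sum>i\<in>{t * a..<t * a + a}. w i * H i j)"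
          proof (rule sum.mono_neutral_right)
            show "\<forall>i\<in>{..<g * a} - {t * a..<t * a + a}. w i * H i j = 0"
            proof
              fix i assume i: "i \<in> {..<g * a} - {t * a..<t * a + a}"
              have "i div a \<noteq> t"
              proof
                assume "i div a = t"
                then have "i = t * a + i mod a" using div_mult_mod_eq[of i a] by simp
                then show False using i mod_less_divisor[OF \<open>0 < a\<close>, of i] by simp
              qed
              then show "w i * H i j = 0" using i that by (auto simp: H_def)
            qed
          qed (use \<open>t * a + a \<le> g * a\<close> in auto)
          also have "\<dots> = (\<Sum>l<a. w (t * a + l) * H (t * a + l) j)"
            by (intro sum.reindex_bij_witness[of _ "\<lambda>l. t * a + l" "\<lambda>i. i - t * a"]) auto
          also have "\<dots> = (\<Sum>l<a. w (t * a + l) * \<alpha> (j mod r) ^ l)"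
            using that \<open>t * a + a \<le> g * a\<close> by (intro sum.cong) (auto simp: H_def)
          also have "\<dots> = poly p (\<alpha> (j mod r))" by (simp add: p_def poly_sum poly_monom)
          finally show ?thesis by simp
        qed
        have "p = 0"
        proof (rule ccontr)
          assume "p \<noteq> 0"
          have "degree p < a"
            unfolding p_def using \<open>0 < a\<close>
            by (intro degree_lessI) (auto simp: coeff_sum)
          have "inj_on (\<lambda>j. \<alpha> (j mod r)) ?J"
          proof (rule inj_onI)
            fix j j' assume j: "j \<in> ?J" "j' \<in> ?J" "\<alpha> (j mod r) = \<alpha> (j' mod r)"
            then have "j mod r = j' mod r"
              using \<open>r > 0\<close> by (intro inj_onD[OF \<alpha>(1)]) auto
            then show "j = j'" using j div_mult_mod_eq[of j r] div_mult_mod_eq[of j' r] by simp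
          qed
          then have "card ?J = card ((\<lambda>j. \<alpha> (j mod r)) ` ?J)" by (rule card_image[symmetric])
          also have "\<dots> \<le> card {x. poly p x = 0}"
            using root poly_roots_finite[OF \<open>p \<noteq> 0\<close>] by (intro card_mono) auto
          also have "\<dots> \<le> degree p" by (rule card_poly_roots_bound[OF \<open>p \<noteq> 0\<close>])
          finally show False using S(3)[OF \<open>t < g\<close>] \<open>degree p < a\<close> by simp
        qed
        have "Polynomial.coeff p i = (\<Sum>l<a. if l = i then w (t * a + i) else 0)"
          unfolding p_def coeff_sum by (intro sum.cong) auto
        then show ?thesis using \<open>p = 0\<close> \<open>i < a\<close> by simp
      qed
      then have local: "w i = 0" if "i < g * a" for i
      proof -
        have "i div a < g" "i mod a < a" using that \<open>0 < a\<close> by (auto simp: less_mult_imp_div_less)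
        then have "w (i div a * a + i mod a) = 0"
          using \<open>\<And>t i. t < g \<Longrightarrow> i < a \<Longrightarrow> w (t * a + i) = 0\<close> by blast
        then show ?thesis by simp
      qed
      show "w i0 = 0"
        using local[of i0] global[of "i0 - g * a"] i0 by (cases "i0 < g * a") auto
    qed
  qed
  moreover have "generates_code ring_copy r a (r - a + 1) (\<lambda>i j. \<phi> (H (t * a + i) (t * r + j)))"
    if "t < g" for t
  proof (rule generates_code_vandermonde[where \<alpha> = \<alpha>])
    fix i j assume ij: "i < a" "j < r"
    have "t * a + a \<le> g * a" using \<open>t < g\<close> mult_le_mono1[of "Suc t" g a] by simp
    then show "\<phi> (H (t * a + i) (t * r + j)) = \<phi> (\<alpha> j ^ i)" using ij by (simp add: H_def)
  qed (use assms \<alpha> FK in auto)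
  ultimately have "MR_LRC_matrix ring_copy (g * r) r h a (\<lambda>i j. \<phi> (H i j))"
    unfolding MR_LRC_matrix_def using \<open>r > 0\<close> HK
    by (auto simp: carrier_ring_copy zero_ring_copy H_def)
  then show ?thesis unfolding g_def by blast
qed

section \<open>Characteristic two, field size and the choice of \<open>n\<close>\<close>

lemma CHAR_bit: "CHAR(bit) = 2"
proof -
  have "of_nat 2 = (0 :: bit)" by simp
  then have "CHAR(bit) dvd 2" by (simp only: of_nat_eq_0_iff_char_dvd)
  moreover have "CHAR(bit) \<noteq> 1" by simp
  ultimately show ?thesis by (metis prime_nat_iff two_is_prime_nat)
qed

lemma MR_LRC_exists_char2:
  assumes "s > 0" "0 < a" "a \<le> r" "r \<le> 2 ^ s" "0 < h" "n = (2 ^ s - 1) * r"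
    and "(n div r) * a + h < n"
  shows "\<exists>F :: nat ring. MR_LRC_exists F n r h a \<and> card (carrier F) = (2 ^ s) ^ r"
proof -
  define q :: nat where "q = 2 ^ s"
  let ?K = "frob_fix (q ^ r) :: bit alg_closure set"
  have CHAR: "CHAR(bit alg_closure) = 2" by (simp add: CHAR_bit)
  have char: "prime CHAR(bit alg_closure)" "q = CHAR(bit alg_closure) ^ s"
      "q ^ r = CHAR(bit alg_closure) ^ (s * r)"
    unfolding CHAR by (simp_all add: q_def power_mult)
  have "r > 0" "n > 0" using assms(2,3,7) by linarith+
  then have K: "finite ?K" "card ?K = q ^ r"
    using card_frob_fix[OF char(1,3)] \<open>s > 0\<close> by auto
  \<comment> \<open>Numbering the finitely many elements of \<open>?K\<close> yields a field whose
    carrier consists of natural numbers.\<close>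
  obtain \<phi> :: "bit alg_closure \<Rightarrow> nat" where inj: "inj_on \<phi> ?K"
    using finite_imp_inj_to_nat_seg[OF K(1)] by blast
  interpret subfield_copy ?K \<phi>
    by unfold_locales (use inj in \<open>auto intro: frob_fix_closed[OF char(1,3)]\<close>)
  have "\<exists>H. MR_LRC_matrix ring_copy n r h a H"
    using MR_LRC_matrix_exists[OF char(1,2) \<open>s > 0\<close> \<open>0 < a\<close> \<open>a \<le> r\<close> _ inj] assms(4,6)
    by (simp add: q_def)
  then have "MR_LRC_exists ring_copy n r h a"
    unfolding MR_LRC_exists_def
    using assms(2,5,7) \<open>r > 0\<close> \<open>n > 0\<close> K(1) \<open>n = (2 ^ s - 1) * r\<close>
    by (auto simp only: field_ring_copy carrier_ring_copy finite_imageI dvd_triv_right)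
  moreover have "card (carrier ring_copy) = (2 ^ s) ^ r"
    unfolding carrier_ring_copy card_image[OF inj] K(2) by (simp add: q_def)
  ultimately show ?thesis by blast
qed

text \<open>Since \<open>1 - \<epsilon> > 1 / 2\<close>, the hypotheses give
  \<open>h * r \<ge> sqrt n \<ge> 2 * r ^ 2 / \<epsilon>\<close>, that is
  \<open>2 * r \<le> \<epsilon> * h\<close>. On the other side \<open>2 ^ s \<le> n ^ 2\<close>, so
  the field has at most \<open>n ^ (2 * r)\<close> elements.\<close>

lemma field_size_bound:
  fixes \<epsilon> :: real
  assumes "0 < r" "0 < \<epsilon>" "\<epsilon> < 1 / 2" "s > 0" "n = (2 ^ s - 1) * r"
    and n: "real n \<ge> (2 * real r ^ 2 / \<epsilon>) ^ 2" "n \<ge> 2"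
    and h: "real (h * r) \<ge> real n powr (1 - \<epsilon>)"
  shows "real ((2 ^ s) ^ r) \<le> real n powr (\<epsilon> * real h)"
proof -
  have "2 * real r ^ 2 / \<epsilon> \<le> sqrt (real n)"
    using n(1) by (intro real_le_rsqrt)
  also have "\<dots> = real n powr (1 / 2)" by (simp add: powr_half_sqrt)
  also have "\<dots> \<le> real n powr (1 - \<epsilon>)" using n(2) assms(3) by (intro powr_mono) auto
  also have "\<dots> \<le> real h * real r" using h by simp
  finally have "2 * real r * real r \<le> \<epsilon> * real h * real r"
    using \<open>0 < \<epsilon>\<close> by (simp add: field_simps power2_eq_square)
  then have exponent: "2 * real r \<le> \<epsilon> * real h" using \<open>0 < r\<close> by simp
  have "(2::nat) ^ s \<ge> 2" using \<open>s > 0\<close> by (metis One_nat_def Suc_leI power_increasing power_one_right one_le_numeral)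
  moreover have "2 ^ s - 1 \<le> n" using assms(1,5) by simp
  ultimately have "2 ^ s \<le> 2 * n" by linarith
  also have "\<dots> \<le> n ^ 2" using n(2) by (simp add: power2_eq_square)
  finally have "(2 ^ s) ^ r \<le> (n ^ 2) ^ r" by (intro power_mono) auto
  then have "real ((2 ^ s) ^ r) \<le> real ((n ^ 2) ^ r)" by (rule of_nat_mono)
  also have "\<dots> = real n powr (2 * real r)"
    using n(2) powr_realpow[of "real n" "2 * r"] by (simp add: power_mult)
  also have "\<dots> \<le> real n powr (\<epsilon> * real h)" using n(2) exponent by (intro powr_mono) auto
  finally show ?thesis .
qed

theorem theorem4p4:
  shows "\<exists>c1 c2 :: real. c1 > 0 \<and> c2 > 0 \<and>
    (\<forall>(a::nat) (r::nat) (\<epsilon>::real). 0 < a \<longrightarrow> a \<le> r \<longrightarrow> 0 < \<epsilon> \<longrightarrow> \<epsilon> < 1/2 \<longrightarrow>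
      infinite {n::nat. r dvd n \<and> real n \<ge> real r powr (c1 * real r / \<epsilon>) \<and>
        (\<forall>h::nat. 0 < h \<longrightarrow> real (h * r) \<ge> c2 * real n powr (1 - \<epsilon>) \<longrightarrow>
           (n div r) * a + h < n \<longrightarrow>
           (\<exists>F :: nat ring. MR_LRC_exists F n r h a \<and>
              real (card (carrier F)) \<le> real n powr (\<epsilon> * real h)))})"
proof (intro exI[of _ 1] conjI allI impI)
  fix a r :: nat and \<epsilon> :: real
  assume ar: "0 < a" "a \<le> r" and \<epsilon>: "0 < \<epsilon>" "\<epsilon> < 1 / 2"
  let ?G = "{n::nat. r dvd n \<and> real n \<ge> real r powr (1 * real r / \<epsilon>) \<and>
        (\<forall>h::nat. 0 < h \<longrightarrow> real (h * r) \<ge> 1 * real n powr (1 - \<epsilon>) \<longrightarrow>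
           (n div r) * a + h < n \<longrightarrow>
           (\<exists>F :: nat ring. MR_LRC_exists F n r h a \<and>
              real (card (carrier F)) \<le> real n powr (\<epsilon> * real h)))}"
  \<comment> \<open>Both constants are 1. The first term of the maximum is the required lower bound
    on \<open>n\<close>, the second the threshold of \<open>field_size_bound\<close>.\<close>
  define N where "N = max (real r powr (real r / \<epsilon>)) ((2 * real r ^ 2 / \<epsilon>) ^ 2)"
  \<comment> \<open>Because \<open>n s \<ge> s\<close>, the first summand secures
    \<open>n s \<ge> N\<close>. The summand \<open>r\<close> gives \<open>r \<le> 2 ^ s\<close>, and
    2 gives \<open>s > 0\<close> and \<open>n s \<ge> 2\<close>.\<close>
  define s0 where "s0 = nat \<lceil>N\<rceil> + r + 2"
  define n where "n s = (2 ^ s - 1) * r" for s :: nat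
  have "n s \<in> ?G" if "s \<ge> s0" for s
  proof -
    have "s < 2 ^ s" by (rule less_exp)
    then have "s \<le> 2 ^ s - 1" by linarith
    also have "\<dots> \<le> n s" using ar by (simp add: n_def)
    finally have "s \<le> n s" .
    have "N \<le> real s" using \<open>s \<ge> s0\<close> unfolding s0_def by linarith
    also have "\<dots> \<le> real (n s)" using \<open>s \<le> n s\<close> by simp
    finally have "N \<le> real (n s)" .
    moreover have "s > 0" "n s \<ge> 2" "r \<le> 2 ^ s"
      using \<open>s \<ge> s0\<close> \<open>s \<le> n s\<close> \<open>s < 2 ^ s\<close> unfolding s0_def by linarith+
    moreover have "0 < r" using ar by simp
    ultimately have "\<exists>F :: nat ring. MR_LRC_exists F (n s) r h a \<and>
        real (card (carrier F)) \<le> real (n s) powr (\<epsilon> * real h)"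
      if "0 < h" "real (h * r) \<ge> 1 * real (n s) powr (1 - \<epsilon>)" "(n s div r) * a + h < n s" for h
      using MR_LRC_exists_char2[of s a r h "n s"] field_size_bound[of r \<epsilon> s "n s" h] ar \<epsilon> that
      by (auto simp: N_def n_def[of s])
    then show ?thesis using \<open>N \<le> real (n s)\<close> by (auto simp: n_def N_def)
  qed
  then have "n ` {s0..} \<subseteq> ?G" by auto
  moreover have "inj_on n {s0..}"
  proof (rule inj_onI)
    fix s t assume "n s = n t"
    then have "(2::nat) ^ s - 1 = 2 ^ t - 1" using ar by (simp add: n_def)
    moreover have "(2::nat) ^ s > 0" "(2::nat) ^ t > 0" by simp_all
    ultimately have "(2::nat) ^ s = 2 ^ t" by linarith
    then show "s = t" by simp
  qed
  then have "infinite (n ` {s0..})" using infinite_Ici by (simp add: finite_image_iff)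
  ultimately show "infinite ?G" using infinite_super by blast
qed auto

end
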